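(* Let $\mathbf v$ be a complementary symmetric Rote sequence starting with the letter $0$, associated with a standard Sturmian sequence $\mathbf u=\mathcal S(\mathbf v)$. Let $x$ be a non-empty prefix of $\mathbf v$ and $w=\mathcal S(x)$; let $r,s$ be the return words to $w$ in $\mathbf u$ with $r$ the more frequent one, and $k$ the positive integer such that $\mathbf u$ is a concatenation of blocks $r^ks$ and $r^{k+1}s$. Then the prefix $x$ of $\mathbf v$ has three return words $A,B,C\in\{0,1\}^+$ satisfying: (i) if $w$ is of type $SU(k)$, then $\mathcal S(A0)=r$, $\mathcal S(B0)=sr^{k+1}s$ and $\mathcal S(C0)=sr^ks$; (ii) if $w$ is of type $US(k)$, then $\mathcal S(A0)=rr$, $\mathcal S(B0)=rsr$ and $\mathcal S(C0)=s$; (iii) if $w$ is of type $UU(k)$, then $\mathcal S(A0)=rr$, $\mathcal S(B0)=rs$ and $\mathcal S(C0)=sr$.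
   Context: A Sturmian sequence is a sequence over $\{0,1\}$ with factor complexity $n+1$ for all $n$; it is standard if $0\mathbf u$ and $1\mathbf u$ are both Sturmian. A complementary symmetric Rote sequence is a sequence over $\{0,1\}$ with factor complexity $2n$ for $n\ge1$ whose set of factors is closed under $0\leftrightarrow1$; it is associated with the Sturmian sequence $\mathcal S(\mathbf v)$, where for words $v_0\cdots v_n$, $\mathcal S(v_0\cdots v_n)=u_0\cdots u_{n-1}$ with $u_i=v_i+v_{i+1}\bmod2$, and analogously for sequences. Throughout, Rote sequences are taken to start with $0$. A return word to a prefix $w$ of $\mathbf u=u_0u_1\cdots$ is $u_i\cdots u_{j-1}$ for consecutive occurrences $i<j$ of $w$. Every prefix $w$ of a standard Sturmian sequence $\mathbf u$ has exactly two return words $r,s$ ($r$ more frequent), and $\mathbf u$ is a concatenation of blocks $r^ks$ and $r^{k+1}s$ for a unique positive integer $k$. A word is stable if it contains an even number of letters $1$, unstable otherwise. The prefix $w$ is of type $SU(k)$ if $r$ is stable and $s$ unstable, of type $US(k)$ if $r$ is unstable and $s$ stable, and of type $UU(k)$ if both are unstable (the case of both stable does not occur). *)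

theory Defs
  imports Complex_Main "HOL-Library.Z2" "HOL-Library.Infinite_Set"
begin

text \<open>Letters are elements of type \<^typ>\<open>bit\<close>, whose addition is addition modulo 2; words are
  lists of letters, and (one-sided infinite) sequences are functions on the naturals.\<close>

text \<open>The word \<open>u\<^sub>i \<dots> u\<^bsub>j-1\<^esub>\<close>.\<close>

definition subword :: "(nat \<Rightarrow> 'a) \<Rightarrow> nat \<Rightarrow> nat \<Rightarrow> 'a list" where
  "subword u i j = map u [i..<j]"

definition occurs_at :: "'a list \<Rightarrow> (nat \<Rightarrow> 'a) \<Rightarrow> nat \<Rightarrow> bool" where
  "occurs_at w u i \<longleftrightarrow> subword u i (i + length w) = w"

definition prefix_of :: "'a list \<Rightarrow> (nat \<Rightarrow> 'a) \<Rightarrow> bool" where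
  "prefix_of w u \<longleftrightarrow> occurs_at w u 0"

definition factors :: "(nat \<Rightarrow> 'a) \<Rightarrow> 'a list set" where
  "factors u = {w. \<exists>i. occurs_at w u i}"

definition factor_complexity :: "(nat \<Rightarrow> 'a) \<Rightarrow> nat \<Rightarrow> nat" where
  "factor_complexity u n = card {w \<in> factors u. length w = n}"

definition sturmian :: "(nat \<Rightarrow> bit) \<Rightarrow> bool" where
  "sturmian u \<longleftrightarrow> (\<forall>n. factor_complexity u n = n + 1)"

text \<open>\<^term>\<open>case_nat a u\<close> is the sequence \<open>au\<close>, i.e. \<open>u\<close> with the letter \<open>a\<close> put in front.\<close>

definition standard_sturmian :: "(nat \<Rightarrow> bit) \<Rightarrow> bool" where
  "standard_sturmian u \<longleftrightarrow>
     sturmian u \<and> sturmian (case_nat 0 u) \<and> sturmian (case_nat 1 u)"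

definition exchange :: "bit list \<Rightarrow> bit list" where
  "exchange w = map (\<lambda>a. a + 1) w"

definition cs_rote :: "(nat \<Rightarrow> bit) \<Rightarrow> bool" where
  "cs_rote v \<longleftrightarrow>
     (\<forall>n\<ge>1. factor_complexity v n = 2 * n) \<and> (\<forall>w \<in> factors v. exchange w \<in> factors v)"

text \<open>The map \<open>\<S>\<close> on sequences and on words; the image of a word of length \<open>n + 1\<close> has length
  \<open>n\<close>.\<close>

definition S_seq :: "(nat \<Rightarrow> bit) \<Rightarrow> nat \<Rightarrow> bit" where
  "S_seq v = (\<lambda>i. v i + v (Suc i))"

definition S_word :: "bit list \<Rightarrow> bit list" where
  "S_word w = map (\<lambda>i. w ! i + w ! Suc i) [0..<length w - 1]"

definition return_words :: "(nat \<Rightarrow> 'a) \<Rightarrow> 'a list \<Rightarrow> 'a list set" where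
  "return_words u w =
     {subword u i j | i j. i < j \<and> occurs_at w u i \<and> occurs_at w u j \<and>
        (\<forall>l. i < l \<and> l < j \<longrightarrow> \<not> occurs_at w u l)}"

text \<open>The sequence of successive return words to \<open>w\<close> in \<open>u\<close> (the derived sequence of \<open>u\<close> to \<open>w\<close>).
  It is meaningful only if \<open>w\<close> occurs infinitely often, as is the case for every factor of a
  Sturmian sequence. If \<open>w\<close> is a prefix of \<open>u\<close>, then \<open>u\<close> is the concatenation of this sequence.\<close>

definition derived_seq :: "(nat \<Rightarrow> 'a) \<Rightarrow> 'a list \<Rightarrow> nat \<Rightarrow> 'a list" where
  "derived_seq u w n =
     subword u (enumerate {i. occurs_at w u i} n) (enumerate {i. occurs_at w u i} (Suc n))"

text \<open>The frequency of a term in a sequence is its asymptotic density.\<close>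

definition has_frequency :: "(nat \<Rightarrow> 'b) \<Rightarrow> 'b \<Rightarrow> real \<Rightarrow> bool" where
  "has_frequency d a \<rho> \<longleftrightarrow> (\<lambda>N. real (card {n. n < N \<and> d n = a}) / real N) \<longlonglongrightarrow> \<rho>"

text \<open>Return words are compared by how often they occur as return words, i.e. as terms of the
  derived sequence. Counting occurrences as factors would be wrong: \<open>0\<close> is the less frequent
  return word to \<open>0\<close> in the Fibonacci sequence \<open>0100101\<dots>\<close>, the other one being \<open>01\<close>.\<close>

definition more_frequent_return :: "(nat \<Rightarrow> 'a) \<Rightarrow> 'a list \<Rightarrow> 'a list \<Rightarrow> 'a list \<Rightarrow> bool" where
  "more_frequent_return u w r s \<longleftrightarrow>
     (\<exists>\<rho> \<sigma>. has_frequency (derived_seq u w) r \<rho> \<and> has_frequency (derived_seq u w) s \<sigma> \<and> \<sigma> < \<rho>)"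

definition word_power :: "'a list \<Rightarrow> nat \<Rightarrow> 'a list" where
  "word_power w n = concat (replicate n w)"

text \<open>\<open>u\<close> is an infinite concatenation \<open>b\<^sub>0 b\<^sub>1 b\<^sub>2 \<dots>\<close> of non-empty words from \<open>X\<close>. As the words
  are non-empty, the prefixes \<open>b\<^sub>0 \<dots> b\<^bsub>n-1\<^esub>\<close> get arbitrarily long and so determine \<open>u\<close>.\<close>

definition concatenation_of :: "(nat \<Rightarrow> 'a) \<Rightarrow> 'a list set \<Rightarrow> bool" where
  "concatenation_of u X \<longleftrightarrow>
     (\<exists>b. (\<forall>n. b n \<in> X \<and> b n \<noteq> []) \<and> (\<forall>n. prefix_of (concat (map b [0..<n])) u))"

definition stable :: "bit list \<Rightarrow> bool" where
  "stable w \<longleftrightarrow> even (count_list w 1)"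

definition type_SU :: "bit list \<Rightarrow> bit list \<Rightarrow> bool" where
  "type_SU r s \<longleftrightarrow> stable r \<and> \<not> stable s"

definition type_US :: "bit list \<Rightarrow> bit list \<Rightarrow> bool" where
  "type_US r s \<longleftrightarrow> \<not> stable r \<and> stable s"

definition type_UU :: "bit list \<Rightarrow> bit list \<Rightarrow> bool" where
  "type_UU r s \<longleftrightarrow> \<not> stable r \<and> \<not> stable s"

end

theory Submission imports Defs "HOL-Library.Sublist" begin

text \<open>The prefix \<open>x\<close> occurs in \<open>v\<close> at \<open>i\<close> iff \<open>w\<close> occurs in \<open>u\<close> at \<open>i\<close> and \<open>v\<^sub>i = 0\<close>, and \<open>v\<^sub>i\<close> changes along
  a factor of \<open>u\<close> by the parity of its number of letters \<open>1\<close>. Since \<open>u\<close> decomposes uniquely into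
  return words to \<open>w\<close>, the return words to \<open>x\<close> correspond to the shortest products of \<open>r\<close> and \<open>s\<close>
  in \<open>u\<close> with even parity. Closure under exchange of letters lets every factor of \<open>u\<close> be read off
  from \<open>v\<close> starting with the letter \<open>0\<close>, so that all of these products contribute, and it
  excludes that \<open>r\<close> and \<open>s\<close> are both stable; aperiodicity of \<open>u\<close> ensures that both kinds of blocks
  occur.\<close>

section \<open>Occurrences of words in a sequence\<close>

lemma occurs_at_iff: "occurs_at w u i \<longleftrightarrow> (\<forall>l<length w. u (i + l) = w ! l)"
  unfolding occurs_at_def subword_def by (subst list_eq_iff_nth_eq) simp

lemma occurs_at_append:
  "occurs_at (a @ b) u i \<longleftrightarrow> occurs_at a u i \<and> occurs_at b u (i + length a)"
proof -
  have "(\<forall>l<m + n. P l) \<longleftrightarrow> (\<forall>l<m. P l) \<and> (\<forall>l<n. P (m + l))" for P and m n :: nat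
    by (metis add_less_cancel_left le_add_diff_inverse linorder_not_less trans_less_add1)
  from this[of "length a" "length b" "\<lambda>l. u (i + l) = (a @ b) ! l"]
  show ?thesis
    by (simp add: occurs_at_iff nth_append add.assoc)
qed

lemma occurs_at_Nil [simp]: "occurs_at [] u i"
  by (simp add: occurs_at_iff)

lemma occurs_at_prefix: "occurs_at b u i \<Longrightarrow> prefix a b \<Longrightarrow> occurs_at a u i"
  by (auto simp: prefix_def occurs_at_append)

lemma occurs_at_subword: "i \<le> j \<Longrightarrow> occurs_at (subword u i j) u i"
  by (simp add: occurs_at_iff subword_def)

lemma occurs_at_imp_subword: "occurs_at w u i \<Longrightarrow> subword u i (i + length w) = w"
  by (simp add: occurs_at_def)

text \<open>Whatever is seen inside one occurrence of \<open>c\<close> is seen at the same offset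
  inside every other one. This carries properties of a return word from the occurrence that defines
  it to all others.\<close>

lemma occurs_at_transfer:
  assumes "occurs_at c u i" "occurs_at c t j" "occurs_at a u (i + l)" "l + length a \<le> length c"
  shows "occurs_at a t (j + l)"
  unfolding occurs_at_iff
proof (intro allI impI)
  fix m assume m: "m < length a"
  then have "l + m < length c" using assms(4) by simp
  then have "t (j + (l + m)) = u (i + (l + m))"
    using assms(1,2) by (simp add: occurs_at_iff)
  then show "t (j + l + m) = a ! m"
    using assms(3) m by (simp add: occurs_at_iff add.assoc)
qed

section \<open>Aperiodicity of Sturmian sequences\<close>

text \<open>A window starting at or beyond \<open>N + p\<close> reads the same after moving it back
  by \<open>p\<close>. Hence every factor already occurs at one of the first \<open>N + p\<close>
  positions.\<close>

lemma factor_complexity_le_if_periodic: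
  assumes "p > 0" and per: "\<And>n. n \<ge> N \<Longrightarrow> u (n + p) = u n"
  shows "factor_complexity u n \<le> N + p"
proof -
  have "\<exists>i'<N + p. subword u i (i + n) = subword u i' (i' + n)" for i
  proof (induction i rule: less_induct)
    case (less i)
    show ?case
    proof (cases "i < N + p")
      case False
      then have "u (i + l) = u (i - p + l)" for l
        using per[of "i - p + l"] by simp
      then have "subword u i (i + n) = subword u (i - p) (i - p + n)"
        by (intro nth_equalityI) (simp_all add: subword_def)
      moreover have "i - p < i" using False \<open>p > 0\<close> by simp
      ultimately show ?thesis using less by metis
    qed blast
  qed
  note reduce = this
  have "{w \<in> factors u. length w = n} \<subseteq> (\<lambda>i. subword u i (i + n)) ` {..<N + p}"
  proof
    fix w assume "w \<in> {w \<in> factors u. length w = n}"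
    then obtain i where "occurs_at w u i" "length w = n"
      by (auto simp: factors_def)
    then have "w = subword u i (i + n)"
      using occurs_at_imp_subword by fastforce
    then show "w \<in> (\<lambda>i. subword u i (i + n)) ` {..<N + p}" using reduce[of i] by auto
  qed
  then have "card {w \<in> factors u. length w = n} \<le> card {..<N + p}"
    by (meson finite_lessThan surj_card_le)
  then show ?thesis by (simp add: factor_complexity_def)
qed

text \<open>The easy half of the Morse-Hedlund theorem: at length \<open>N + p\<close>, the bound
  \<open>N + p\<close> for the periodic case contradicts the complexity
  \<open>N + p + 1\<close>.\<close>

lemma sturmian_not_eventually_periodic:
  assumes "sturmian u" "p > 0"
  shows "\<exists>n\<ge>N. u (n + p) \<noteq> u n"
proof (rule ccontr)
  assume "\<not> ?thesis"
  then have "factor_complexity u (N + p) \<le> N + p"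
    using factor_complexity_le_if_periodic[of p N u] assms(2) by blast
  then show False using assms(1) by (simp add: sturmian_def)
qed

section \<open>Unique decomposition into return words\<close>

locale two_return_words =
  fixes u :: "nat \<Rightarrow> 'a" and w r s :: "'a list"
  assumes return_words_eq: "return_words u w = {r, s}" and r_neq_s: "r \<noteq> s"
begin

lemma return_word_occurrence:
  assumes "z \<in> {r, s}"
  obtains i where "z \<noteq> []" "occurs_at (z @ w) u i" "occurs_at w u i"
    "\<And>l. 0 < l \<Longrightarrow> l < length z \<Longrightarrow> \<not> occurs_at w u (i + l)"
proof -
  from assms have "z \<in> return_words u w" by (simp add: return_words_eq)
  then obtain i j where ij: "z = subword u i j" "i < j" "occurs_at w u i" "occurs_at w u j"
    "\<And>l. i < l \<Longrightarrow> l < j \<Longrightarrow> \<not> occurs_at w u l"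
    unfolding return_words_def by blast
  have len: "length z = j - i" using ij by (simp add: subword_def)
  show thesis
  proof (rule that[of i])
    show "z \<noteq> []" using len \<open>i < j\<close> by auto
    show "occurs_at (z @ w) u i"
      using ij len occurs_at_subword[of i j u] by (simp add: occurs_at_append)
    show "occurs_at w u i" by fact
    show "\<not> occurs_at w u (i + l)" if "0 < l" "l < length z" for l
      using ij(5)[of "i + l"] that len by simp
  qed
qed

lemma return_word_nonempty: "z \<in> {r, s} \<Longrightarrow> z \<noteq> []"
  using return_word_occurrence by blast

text \<open>Both words occur at the position where \<open>z\<close> is a return word, and
  \<open>w\<close> is the shorter one. This covers the case that the two occurrences of
  \<open>w\<close> overlap.\<close>

lemma prefix_return_word:
  assumes "z \<in> {r, s}"
  shows "prefix w (z @ w)"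
proof -
  obtain i where "occurs_at (z @ w) u i" "occurs_at w u i"
    using return_word_occurrence[OF assms] by blast
  then have "w = take (length w) (z @ w)"
    by (intro nth_equalityI) (auto simp: occurs_at_iff simp del: take_append)
  then show ?thesis by (metis take_is_prefix)
qed

lemma prefix_concat_return_words: "cs \<in> lists {r, s} \<Longrightarrow> prefix w (concat cs @ w)"
proof (induction cs)
  case (Cons z cs)
  then have "prefix (z @ w) (z @ concat cs @ w)" by simp
  moreover have "prefix w (z @ w)" using Cons prefix_return_word by auto
  ultimately show ?case using prefix_order.order_trans by fastforce
qed simp

text \<open>The discarded part \<open>concat ds @ w\<close> begins with \<open>w\<close>, so the
  shortened product is still followed by \<open>w\<close>.\<close>

lemma occurs_at_decode_prefix:
  assumes "occurs_at (concat (cs @ ds) @ w) u i" "ds \<in> lists {r, s}"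
  shows "occurs_at (concat cs @ w) u i"
proof -
  have "occurs_at (concat ds @ w) u (i + length (concat cs))"
    using assms(1) by (simp add: occurs_at_append add.assoc)
  then have "occurs_at w u (i + length (concat cs))"
    using prefix_concat_return_words[OF assms(2)] occurs_at_prefix by blast
  then show ?thesis using assms(1) by (simp add: occurs_at_append)
qed

text \<open>The claim holds where \<open>z\<close> arises as a return word. An occurrence of
  \<open>w\<close> at offset \<open>l < length z\<close> fits inside \<open>z @ w\<close>, so it
  could be transferred there.\<close>

lemma not_occurs_at_inside:
  assumes "z \<in> {r, s}" "occurs_at (z @ w) u i" "0 < l" "l < length z"
  shows "\<not> occurs_at w u (i + l)"
proof
  assume occ: "occurs_at w u (i + l)"
  obtain j where "occurs_at (z @ w) u j" "\<not> occurs_at w u (j + l)"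
    using return_word_occurrence[OF assms(1)] assms(3,4) by metis
  with occ assms(2,4) show False
    using occurs_at_transfer[of "z @ w" u i u j w l] by simp
qed

text \<open>If the lengths differed, the end of the shorter return word would be an occurrence of
  \<open>w\<close> strictly inside the longer one.\<close>

lemma return_word_unique:
  assumes "y \<in> {r, s}" "z \<in> {r, s}" "occurs_at (y @ w) u i" "occurs_at (z @ w) u i"
  shows "y = z"
proof -
  have *: "\<not> length y < length z"
    if "y \<in> {r, s}" "z \<in> {r, s}" "occurs_at (y @ w) u i" "occurs_at (z @ w) u i" for y z
    using not_occurs_at_inside[OF that(2,4), of "length y"] return_word_nonempty[OF that(1)] that(3)
    by (auto simp: occurs_at_append)
  have "length y = length z" using *[of y z] *[of z y] assms by auto
  then show ?thesis using assms(3,4) by (simp add: occurs_at_append occurs_at_def)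
qed

lemma occurs_at_concat_hd:
  assumes "occurs_at (concat (z # cs) @ w) u i" "z # cs \<in> lists {r, s}"
  shows "occurs_at (z @ w) u i" "occurs_at (concat cs @ w) u (i + length z)"
  using occurs_at_decode_prefix[of "[z]" cs i] assms by (auto simp: occurs_at_append)

lemma decode_unique:
  assumes "occurs_at (concat cs @ w) u i" "occurs_at (concat ds @ w) u i"
    and "cs \<in> lists {r, s}" "ds \<in> lists {r, s}" "length (concat cs) = length (concat ds)"
  shows "cs = ds"
  using assms
proof (induction cs arbitrary: ds i)
  case Nil
  then show ?case using return_word_nonempty by (cases ds) auto
next
  case (Cons z cs)
  then obtain y ds' where ds: "ds = y # ds'"
    using return_word_nonempty by (cases ds) auto
  have z: "z \<in> {r, s}" and y: "y \<in> {r, s}" using Cons.prems ds by auto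
  have "z = y"
    using return_word_unique[OF z y] occurs_at_concat_hd Cons.prems ds by metis
  moreover have "cs = ds'"
    using Cons.IH[of "i + length z" ds'] occurs_at_concat_hd Cons.prems ds \<open>z = y\<close>
    by (auto simp: occurs_at_append add.assoc)
  ultimately show ?case using ds by simp
qed

text \<open>No occurrence of \<open>w\<close> starts strictly inside a return word, so only the
  boundaries between the factors remain.\<close>

lemma occurrence_position:
  assumes "occurs_at (concat cs @ w) u i" "cs \<in> lists {r, s}"
    and "occurs_at w u (i + l)" "l \<le> length (concat cs)"
  shows "\<exists>n\<le>length cs. l = length (concat (take n cs))"
  using assms
proof (induction cs arbitrary: i l)
  case (Cons z cs)
  note hd = occurs_at_concat_hd[OF Cons.prems(1,2)]
  consider "l = 0" | "0 < l" "l < length z" | "length z \<le> l" by linarith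
  then show ?case
  proof cases
    case 1
    then show ?thesis by (intro exI[of _ 0]) simp
  next
    case 2
    then show ?thesis using not_occurs_at_inside[OF _ hd(1)] Cons.prems by auto
  next
    case 3
    have "i + length z + (l - length z) = i + l" using 3 by simp
    then obtain n where "n \<le> length cs" "l - length z = length (concat (take n cs))"
      using Cons.IH[OF hd(2), of "l - length z"] Cons.prems by auto
    then show ?thesis using 3 by (intro exI[of _ "Suc n"]) simp
  qed
qed simp

lemma next_return_word:
  assumes "occurs_at w u i" "occurs_at w u j" "i < j"
  shows "\<exists>z\<in>{r, s}. occurs_at (z @ w) u i"
proof -
  \<comment> \<open>The next occurrence of \<open>w\<close> after \<open>i\<close>; the return word
    sought runs from \<open>i\<close> to \<open>m\<close>.\<close>
  define m where "m = (LEAST m. i < m \<and> occurs_at w u m)"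
  have m: "i < m \<and> occurs_at w u m"
    unfolding m_def by (rule LeastI[of _ j]) (use assms in simp)
  have "\<not> occurs_at w u l" if "i < l" "l < m" for l
    using that not_less_Least[of l "\<lambda>m. i < m \<and> occurs_at w u m"] unfolding m_def by blast
  then have "subword u i m \<in> return_words u w"
    using assms(1) m unfolding return_words_def by blast
  moreover have "occurs_at (subword u i m @ w) u i"
    using m occurs_at_subword[of i m u] by (simp add: occurs_at_append) (simp add: subword_def)
  ultimately show ?thesis using return_words_eq by blast
qed

end

section \<open>Sequences composed of two kinds of blocks\<close>

text \<open>The condition \<open>concatenation_of\<close>: the \<open>n\<close>-th block is \<open>r\<^bsup>e n\<^esup>s\<close> and starts at position \<open>q n\<close>.\<close>

locale sturmian_blocks = two_return_words +
  fixes k :: nat and e :: "nat \<Rightarrow> nat" and q :: "nat \<Rightarrow> nat"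
  assumes k_pos: "k > 0" and e_range: "e n \<in> {k, k + 1}"
    and q_0: "q 0 = 0" and q_Suc: "q (Suc n) = q n + length (concat (replicate (e n) r @ [s]))"
    and block_at: "occurs_at (concat (replicate (e n) r @ [s])) u (q n)"
    and aperiodic: "p > 0 \<Longrightarrow> \<exists>n\<ge>N. u (n + p) \<noteq> u n"
begin

abbreviation "block n \<equiv> replicate (e n) r @ [s]"

lemma q_less: "q n < q (Suc n)"
  using return_word_nonempty[of s] by (simp add: q_Suc)

lemma q_strict_mono: "strict_mono q"
  by (simp add: strict_mono_Suc_iff q_less)

lemma blocks_at: "occurs_at (concat (concat (map block [n..<n + m]))) u (q n) \<and>
    q (n + m) = q n + length (concat (concat (map block [n..<n + m])))"
proof (induction m)
  case (Suc m)
  then show ?case using block_at[of "n + m"] q_Suc[of "n + m"]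
    by (auto simp: occurs_at_append)
qed simp

text \<open>The blocks alone do not mention \<open>w\<close>. But \<open>w\<close> is a prefix of
  any product of return words followed by \<open>w\<close>, hence of any product that is at least as
  long as \<open>w\<close>; as blocks are non-empty, \<open>length w\<close> of them
  suffice.\<close>

lemma occurs_at_q: "occurs_at w u (q n)"
proof -
  let ?cs = "concat (map block [n..<n + length w])"
  have cs: "?cs \<in> lists {r, s}" by (auto split: if_splits)
  have "q n + m \<le> q (n + m)" for m
    by (induction m) (use q_less in \<open>auto simp: Suc_le_eq intro: le_less_trans\<close>)
  then have len: "length w \<le> length (concat ?cs)"
    using blocks_at[of n "length w"] by (metis add_le_cancel_left)
  have "prefix w (concat ?cs)"
    using prefix_concat_return_words[OF cs] len
    by (metis prefix_length_prefix prefixI)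
  then show ?thesis using blocks_at occurs_at_prefix by blast
qed

lemma block_w_at: "occurs_at (concat (block n) @ w) u (q n)"
  using block_at[of n] occurs_at_q[of "Suc n"] q_Suc[of n] by (simp add: occurs_at_append add.assoc)

lemma next_return_word': "occurs_at w u i \<Longrightarrow> \<exists>z\<in>{r, s}. occurs_at (z @ w) u i"
  \<comment> \<open>As \<open>q\<close> is strictly increasing, \<open>q (Suc i)\<close> is an
    occurrence of \<open>w\<close> beyond \<open>i\<close>.\<close>
  using next_return_word[of i "q (Suc i)"] occurs_at_q
    strict_mono_imp_increasing[OF q_strict_mono, of "Suc i"]
  by (simp add: Suc_le_eq)

lemma locate: "\<exists>m. q m \<le> i \<and> i < q (Suc m)"
proof (induction i)
  case 0
  then show ?case using q_0 q_less[of 0] by (intro exI[of _ 0]) simp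
next
  case (Suc i)
  then obtain m where m: "q m \<le> i" "i < q (Suc m)" by blast
  show ?case
  proof (cases "Suc i < q (Suc m)")
    case True
    with m show ?thesis by (intro exI[of _ m]) simp
  next
    case False
    with m q_less[of "Suc m"] show ?thesis by (intro exI[of _ "Suc m"]) simp
  qed
qed

text \<open>The position \<open>i\<close> is a boundary inside some block. If the factor starting
  there were an \<open>r\<close>, both \<open>r @ w\<close> and \<open>s @ w\<close> would occur at
  \<open>i\<close>; so it is the final \<open>s\<close>.\<close>

lemma s_ends_block:
  assumes "occurs_at (s @ w) u i"
  shows "\<exists>m. i + length s = q (Suc m)"
proof -
  obtain m where m: "q m \<le> i" "i < q (Suc m)" using locate by blast
  have cs: "block m \<in> lists {r, s}" by auto
  have "occurs_at w u (q m + (i - q m))"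
    using prefix_return_word[of s] assms occurs_at_prefix m by simp
  moreover have "i - q m \<le> length (concat (block m))" using m q_Suc[of m] by linarith
  ultimately obtain n where n: "n \<le> length (block m)" "i - q m = length (concat (take n (block m)))"
    using occurrence_position[OF block_w_at cs] by blast
  have i: "i = q m + length (concat (take n (block m)))" using n m by simp
  have "n = e m"
  proof (rule ccontr)
    assume "n \<noteq> e m"
    \<comment> \<open>This index would put \<open>i\<close> at the start of the next block.\<close>
    moreover have "n \<noteq> Suc (e m)"
      using m i q_Suc[of m] by auto
    ultimately have less: "n < e m" using n by simp
    have "block m = take n (block m) @ r # drop (Suc n) (block m)"
      using less id_take_nth_drop[of n "block m"] by (simp add: nth_append)
    then have "occurs_at (concat (take n (block m) @ r # drop (Suc n) (block m)) @ w) u (q m)"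
      using block_w_at[of m] by metis
    then have "occurs_at (concat (r # drop (Suc n) (block m)) @ w) u i"
      by (simp add: occurs_at_append i add.assoc)
    moreover have "r # drop (Suc n) (block m) \<in> lists {r, s}"
      using cs by (meson lists.Cons insertI1 in_listsI in_listsD in_set_dropD)
    ultimately have "occurs_at (r @ w) u i" by (rule occurs_at_concat_hd)
    then show False using return_word_unique[of r s i] assms r_neq_s by simp
  qed
  then show ?thesis using i q_Suc[of m] by (intro exI[of _ m]) simp
qed

lemma after_s:
  assumes "occurs_at (s @ w) u i"
  shows "\<exists>j\<in>{k, k + 1}. occurs_at (concat (s # replicate j r @ [s]) @ w) u i"
proof -
  obtain m where "i + length s = q (Suc m)" using s_ends_block[OF assms] by blast
  then have "occurs_at (concat (s # replicate (e (Suc m)) r @ [s]) @ w) u i"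
    using block_w_at[of "Suc m"] assms by (simp add: occurs_at_append add.assoc)
  then show ?thesis using e_range by blast
qed

text \<open>Otherwise \<open>u\<close> would be periodic from \<open>q 1\<close> on, with the length
  of one block as period. Block 0 is left out so that the block found has a predecessor.\<close>

lemma not_eventually_constant: "\<exists>m\<ge>1. e m \<noteq> j"
proof (rule ccontr)
  assume "\<not> ?thesis"
  then have e: "e m = j" if "m \<ge> 1" for m using that by blast
  let ?c = "concat (replicate j r @ [s])"
  have "length ?c > 0" using return_word_nonempty[of s] by simp
  then obtain n where n: "n \<ge> q 1" "u (n + length ?c) \<noteq> u n"
    using aperiodic by blast
  obtain m where m: "q m \<le> n" "n < q (Suc m)" using locate by blast
  have "m \<ge> 1" using m n(1) by (cases m) auto
  then have "q (Suc m) = q m + length ?c" and em: "e m = j" "e (Suc m) = j"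
    using q_Suc[of m] e[of m] e[of "Suc m"] by auto
  moreover from this have "u n = ?c ! (n - q m)"
    using block_at[of m] m unfolding occurs_at_iff by (metis em(1) le_add_diff_inverse add_less_cancel_left)
  moreover have "n - q m < length ?c" using m \<open>q (Suc m) = _\<close> by simp
  then have "u (q (Suc m) + (n - q m)) = ?c ! (n - q m)"
    using block_at[of "Suc m"] unfolding occurs_at_iff em by blast
  moreover have "q (Suc m) + (n - q m) = n + length ?c" using m \<open>q (Suc m) = _\<close> by simp
  ultimately show False using n(2) by metis
qed

text \<open>An exponent different from \<open>k\<close> is \<open>k + 1\<close> and conversely, so
  both values are taken at positive indices. The leading \<open>s\<close> is the end of the
  preceding block.\<close>

lemma s_power_s_occurs:
  assumes "j \<in> {k, k + 1}"
  shows "\<exists>i. occurs_at (concat (s # replicate j r @ [s]) @ w) u i"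
proof -
  obtain m where "m \<ge> 1" "e m = j"
    using not_eventually_constant[of k] not_eventually_constant[of "k + 1"] e_range assms by blast
  then obtain m' where m: "m = Suc m'" "e (Suc m') = j" by (cases m) auto
  have "occurs_at (concat (s # block m) @ w) u (q m' + length (concat (replicate (e m') r)))"
    using block_w_at[of m'] block_w_at[of m] q_Suc[of m'] m
    by (simp add: occurs_at_append ac_simps)
  then show ?thesis using m by auto
qed

end

section \<open>The map \<open>S_seq\<close>, parity and the exchange of letters\<close>

lemma bit_add_eq_iff: "a + b = c \<longleftrightarrow> b = a + c" for a b c :: bit
  by (cases a; cases b; cases c) simp_all

lemma bit_add_add_self: "a + (a + b) = b" for a b :: bit
  by (cases a; cases b) simp_all

lemma length_S_word [simp]: "length (S_word x) = length x - 1"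
  by (simp add: S_word_def)

lemma nth_S_word: "l < length x - 1 \<Longrightarrow> S_word x ! l = x ! l + x ! Suc l"
  by (simp add: S_word_def)

text \<open>The sum of \<open>v l + v (Suc l)\<close> telescopes modulo 2.\<close>

lemma S_seq_shift:
  assumes "occurs_at z (S_seq v) i"
  shows "v (i + length z) = v i + sum_list z"
  using assms
proof (induction z arbitrary: i)
  case (Cons a z)
  then have "v i + v (Suc i) = a" "occurs_at z (S_seq v) (Suc i)"
    using occurs_at_append[of "[a]" z] by (auto simp: occurs_at_iff S_seq_def)
  then have "v (Suc i) = v i + a" "v (Suc i + length z) = v (Suc i) + sum_list z"
    using Cons.IH unfolding bit_add_eq_iff by blast+
  then have "v (Suc i + length z) = v i + (a + sum_list z)"
    by (simp only: add.assoc)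
  then show ?case by (simp only: list.size sum_list.Cons add_Suc add_Suc_right add_0_right One_nat_def)
qed simp

text \<open>A word is determined by its first letter and the sums of its neighbouring
  letters.\<close>

lemma occurs_at_S_word_iff:
  assumes "x \<noteq> []"
  shows "occurs_at x v i \<longleftrightarrow> v i = hd x \<and> occurs_at (S_word x) (S_seq v) i"
proof
  assume "occurs_at x v i"
  then have x: "v (i + l) = x ! l" if "l < length x" for l
    using that by (simp add: occurs_at_iff)
  then have "v i = hd x" using x[of 0] assms by (simp add: hd_conv_nth)
  moreover have "S_seq v (i + l) = S_word x ! l" if "l < length x - 1" for l
    using that x[of l] x[of "Suc l"] by (simp add: S_seq_def nth_S_word)
  ultimately show "v i = hd x \<and> occurs_at (S_word x) (S_seq v) i"
    by (simp add: occurs_at_iff)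
next
  assume *: "v i = hd x \<and> occurs_at (S_word x) (S_seq v) i"
  have "v (i + l) = x ! l" if "l < length x" for l
    using that
  proof (induction l)
    case 0
    then show ?case using * assms by (simp add: hd_conv_nth)
  next
    case (Suc l)
    then have "v (i + l) + v (Suc (i + l)) = x ! l + x ! Suc l"
      using * nth_S_word[of l x] unfolding occurs_at_iff S_seq_def
      by (metis Suc_lessE add_Suc_right diff_Suc_1 length_S_word Suc_less_eq)
    then show ?case using Suc by (metis Suc_lessD add_Suc_right add_left_cancel)
  qed
  then show "occurs_at x v i" by (simp add: occurs_at_iff)
qed

text \<open>The letters of \<open>v\<close> read along an occurrence of \<open>z\<close> in
  \<open>S_seq v\<close> when the first one is 0. The total sum is left out: it is the letter of
  \<open>v\<close> just after this stretch.\<close>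

definition partial_sums :: "bit list \<Rightarrow> bit list" where
  "partial_sums z = map (\<lambda>l. sum_list (take l z)) [0..<length z]"

lemma subword_eq_partial_sums:
  assumes "v i = 0" "occurs_at z (S_seq v) i"
  shows "subword v i (i + length z) = partial_sums z"
proof (intro nth_equalityI)
  fix l assume "l < length (subword v i (i + length z))"
  then have l: "l < length z" by (simp add: subword_def)
  moreover have "occurs_at (take l z) (S_seq v) i"
    using assms(2) occurs_at_prefix take_is_prefix by blast
  ultimately show "subword v i (i + length z) ! l = partial_sums z ! l"
    using S_seq_shift[of "take l z" v i] assms(1) by (simp add: subword_def partial_sums_def)
qed (simp add: subword_def partial_sums_def)

text \<open>For \<open>z\<close> of sum 0, the appended \<open>0\<close> is exactly the total sum
  omitted by \<open>partial_sums\<close>.\<close>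

lemma S_word_partial_sums:
  assumes "sum_list z = 0"
  shows "S_word (partial_sums z @ [0]) = z"
proof (intro nth_equalityI)
  fix l assume "l < length (S_word (partial_sums z @ [0]))"
  then have l: "l < length z" by (simp add: partial_sums_def)
  have "(partial_sums z @ [0]) ! m = sum_list (take m z)" if "m \<le> length z" for m
    using that assms by (auto simp: nth_append partial_sums_def)
  then have "S_word (partial_sums z @ [0]) ! l = sum_list (take l z) + sum_list (take (Suc l) z)"
    using l nth_S_word[of l "partial_sums z @ [0]"] by (simp add: partial_sums_def)
  also have "\<dots> = z ! l"
    using l by (simp only: take_Suc_conv_app_nth sum_list_append bit_add_add_self) simp
  finally show "S_word (partial_sums z @ [0]) ! l = z ! l" .
qed (simp add: partial_sums_def)

lemma stable_iff_sum_list: "stable z \<longleftrightarrow> sum_list z = 0"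
proof (induction z)
  case (Cons a z)
  then show ?case by (cases a; cases "sum_list z") (auto simp: stable_def)
qed (simp add: stable_def)

text \<open>Exchanging the letters of \<open>v\<close> leaves the sums of neighbours unchanged but
  flips the initial letter.\<close>

lemma occurs_at_with_letter:
  assumes "\<forall>w \<in> factors v. exchange w \<in> factors v" "occurs_at f (S_seq v) i"
  shows "\<exists>j. occurs_at f (S_seq v) j \<and> v j = a"
proof (cases "v i = a")
  case False
  \<comment> \<open>One letter longer than \<open>f\<close>, since each letter of \<open>f\<close>
    is a sum of two neighbours.\<close>
  let ?y = "subword v i (i + Suc (length f))"
  have "?y \<in> factors v"
    unfolding factors_def using occurs_at_subword[of i "i + Suc (length f)" v] by auto
  then obtain j where "occurs_at (exchange ?y) v j"
    using assms(1) unfolding factors_def by blast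
  then have j: "v (j + l) = v (i + l) + 1" if "l \<le> length f" for l
    using that unfolding occurs_at_iff exchange_def subword_def by (simp del: upt_Suc)
  have "v j = a" using j[of 0] False by (cases a; cases "v i") simp_all
  moreover have "S_seq v (j + l) = S_seq v (i + l)" if "l < length f" for l
    using j[of l] j[of "Suc l"] that
    by (cases "v (i + l)"; cases "v (i + Suc l)") (simp_all add: S_seq_def)
  ultimately show ?thesis using assms(2) by (auto simp: occurs_at_iff)
qed (use assms in blast)

section \<open>Return words to \<open>x\<close> as first returns to the letter 0\<close>

text \<open>A word \<open>cs\<close> over the alphabet \<open>{r, s}\<close> of return words in \<open>\<S>(v)\<close> that brings the letter of \<open>v\<close>
  back to its initial value for the first time.\<close>

definition first_return :: "bit list list \<Rightarrow> bool" where
  "first_return cs \<longleftrightarrow> cs \<noteq> [] \<and> sum_list (concat cs) = 0 \<and>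
     (\<forall>n. 0 < n \<and> n < length cs \<longrightarrow> sum_list (concat (take n cs)) = 1)"

locale rote_blocks = sturmian_blocks u w r s k e q
  for u :: "nat \<Rightarrow> bit" and w r s k e q +
  fixes v :: "nat \<Rightarrow> bit" and x :: "bit list"
  assumes u_eq: "u = S_seq v" and exchange_closed: "\<forall>f \<in> factors v. exchange f \<in> factors v"
    and x_nonempty: "x \<noteq> []" and hd_x: "hd x = 0" and v_0: "v 0 = 0" and w_eq: "w = S_word x"
begin

lemma occurs_x_iff: "occurs_at x v i \<longleftrightarrow> v i = 0 \<and> occurs_at w u i"
  using occurs_at_S_word_iff[OF x_nonempty] hd_x u_eq w_eq by simp

lemma v_shift: "occurs_at z u i \<Longrightarrow> v (i + length z) = v i + sum_list z"
  using S_seq_shift u_eq by simp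

text \<open>Inside \<open>concat cs\<close>, the word \<open>w\<close> occurs only at boundaries
  between factors. There \<open>v\<close> has the letter 1, which excludes \<open>x\<close>; at the
  end the sum is 0, so \<open>x\<close> occurs again.\<close>

lemma first_return_gap:
  assumes "first_return cs" "cs \<in> lists {r, s}" "v i = 0" "occurs_at (concat cs @ w) u i"
  shows "occurs_at x v i" "concat cs \<noteq> []" "occurs_at x v (i + length (concat cs))"
    "0 < l \<Longrightarrow> l < length (concat cs) \<Longrightarrow> \<not> occurs_at x v (i + l)"
proof -
  have "occurs_at w u i"
    using occurs_at_decode_prefix[of "[]" cs i] assms by simp
  then show "occurs_at x v i" using occurs_x_iff assms(3) by simp
  show "concat cs \<noteq> []"
    using assms(1,2) return_word_nonempty by (cases cs) (auto simp: first_return_def)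
  show "occurs_at x v (i + length (concat cs))"
    using assms v_shift[of "concat cs" i] unfolding first_return_def
    by (simp add: occurs_x_iff occurs_at_append)
  show "\<not> occurs_at x v (i + l)" if l: "0 < l" "l < length (concat cs)"
  proof
    assume "occurs_at x v (i + l)"
    then have occ: "v (i + l) = 0" "occurs_at w u (i + l)" by (auto simp: occurs_x_iff)
    then obtain n where n: "n \<le> length cs" "l = length (concat (take n cs))"
      using occurrence_position[OF assms(4,2)] less_imp_le[OF l(2)] by blast
    then have "0 < n" "n \<noteq> length cs" using l by (auto intro: gr0I)
    then have "sum_list (concat (take n cs)) = 1"
      using assms(1) n unfolding first_return_def by simp
    moreover have "occurs_at (concat (take n cs @ drop n cs) @ w) u i" using assms(4) by simp
    then have "occurs_at (concat (take n cs)) u i"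
      unfolding concat_append occurs_at_append by blast
    ultimately show False using v_shift[of "concat (take n cs)" i] n occ assms(3) by simp
  qed
qed

text \<open>Reduces the theorem to finding \<open>CS\<close>. By \<open>cover\<close> every return
  word to \<open>x\<close> comes from \<open>CS\<close>; by \<open>occ\<close> and closure under
  exchange every element of \<open>CS\<close> is met starting with the letter 0.\<close>

lemma return_words_eq_first_returns:
  assumes lists: "CS \<subseteq> lists {r, s}" and first: "\<And>cs. cs \<in> CS \<Longrightarrow> first_return cs"
    and occ: "\<And>cs. cs \<in> CS \<Longrightarrow> \<exists>i. occurs_at (concat cs @ w) u i"
    and cover: "\<And>i. occurs_at w u i \<Longrightarrow> \<exists>cs\<in>CS. occurs_at (concat cs @ w) u i"
  shows "return_words v x = (\<lambda>cs. partial_sums (concat cs)) ` CS"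
proof (intro equalityI subsetI)
  fix y assume "y \<in> return_words v x"
  then obtain i j where ij: "y = subword v i j" "i < j" "occurs_at x v i" "occurs_at x v j"
    "\<And>l. i < l \<Longrightarrow> l < j \<Longrightarrow> \<not> occurs_at x v l"
    unfolding return_words_def by blast
  then have i: "v i = 0" "occurs_at w u i" using occurs_x_iff by auto
  then obtain cs where cs: "cs \<in> CS" "occurs_at (concat cs @ w) u i" using cover by blast
  note gap = first_return_gap[OF first[OF cs(1)] _ i(1) cs(2)]
  have "cs \<in> lists {r, s}" using cs lists by blast
  \<comment> \<open>Both sides are the first occurrence of \<open>x\<close> after
    \<open>i\<close>.\<close>
  then have "j = i + length (concat cs)"
    using gap(2) gap(3) gap(4)[of "j - i"] ij(2,4) ij(5)[of "i + length (concat cs)"]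
    by (metis add_diff_inverse_nat length_greater_0_conv less_add_same_cancel1 less_asym
        linorder_neqE_nat nat_add_left_cancel_less zero_less_diff)
  then have "y = partial_sums (concat cs)"
    using subword_eq_partial_sums[of v i "concat cs"] i cs ij(1) u_eq by (simp add: occurs_at_append)
  then show "y \<in> (\<lambda>cs. partial_sums (concat cs)) ` CS" using cs by blast
next
  fix y assume "y \<in> (\<lambda>cs. partial_sums (concat cs)) ` CS"
  then obtain cs where cs: "cs \<in> CS" "y = partial_sums (concat cs)" by blast
  obtain i where i: "occurs_at (concat cs @ w) u i" "v i = 0"
    using occ[OF cs(1)] occurs_at_with_letter[OF exchange_closed] u_eq by metis
  have "cs \<in> lists {r, s}" using cs lists by blast
  note gap = first_return_gap[OF first[OF cs(1)] this i(2,1)]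
  have "y = subword v i (i + length (concat cs))"
    using subword_eq_partial_sums[of v i "concat cs"] i cs u_eq by (simp add: occurs_at_append)
  moreover have "\<not> occurs_at x v l" if "i < l" "l < i + length (concat cs)" for l
    using gap(4)[of "l - i"] that by simp
  moreover have "i < i + length (concat cs)" using gap(2) by (simp del: concat_eq_Nil_conv)
  ultimately show "y \<in> return_words v x"
    using gap(1,3) unfolding return_words_def by blast
qed

text \<open>The words are distinct because \<open>S_word\<close> recovers the products from them,
  and unique decoding recovers the elements of \<open>CS\<close> from the products.\<close>

lemma three_return_words:
  assumes "CS = {a, b, c}" "distinct [a, b, c]"
    and lists: "CS \<subseteq> lists {r, s}" and first: "\<And>cs. cs \<in> CS \<Longrightarrow> first_return cs"
    and occ: "\<And>cs. cs \<in> CS \<Longrightarrow> \<exists>i. occurs_at (concat cs @ w) u i"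
    and cover: "\<And>i. occurs_at w u i \<Longrightarrow> \<exists>cs\<in>CS. occurs_at (concat cs @ w) u i"
  shows "\<exists>A B C. A \<noteq> [] \<and> B \<noteq> [] \<and> C \<noteq> [] \<and> distinct [A, B, C] \<and>
    return_words v x = {A, B, C} \<and> S_word (A @ [0]) = concat a \<and>
    S_word (B @ [0]) = concat b \<and> S_word (C @ [0]) = concat c"
proof -
  let ?f = "\<lambda>cs. partial_sums (concat cs)"
  have S: "S_word (?f cs @ [0]) = concat cs" if "cs \<in> CS" for cs
    using first[OF that] S_word_partial_sums unfolding first_return_def by blast
  have "inj_on ?f CS"
  proof (rule inj_onI)
    fix cs ds assume *: "cs \<in> CS" "ds \<in> CS" "?f cs = ?f ds"
    then have "concat cs = concat ds" using S by metis
    then show "cs = ds" using decode_unique[of cs _ ds] occ[OF *(1)] * lists by auto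
  qed
  then have "distinct [?f a, ?f b, ?f c]"
    using assms(1,2) by (auto dest: inj_onD)
  moreover have "?f cs \<noteq> []" if "cs \<in> CS" for cs
  proof -
    have "cs \<noteq> []" "cs \<in> lists {r, s}" using first[OF that] lists that by (auto simp: first_return_def)
    then have "concat cs \<noteq> []" using return_word_nonempty by (cases cs) auto
    then show ?thesis by (simp add: partial_sums_def)
  qed
  moreover have "return_words v x = {?f a, ?f b, ?f c}"
    using return_words_eq_first_returns[OF lists first occ cover] assms(1) by simp
  ultimately show ?thesis
    using S[of a] S[of b] S[of c] assms(1)
    by (intro exI[of _ "?f a"] exI[of _ "?f b"] exI[of _ "?f c"] conjI) simp_all
qed

lemma occurs_infix:
  assumes "occurs_at (concat (cs @ ds @ es) @ w) u i" "es \<in> lists {r, s}"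
  shows "\<exists>j. occurs_at (concat ds @ w) u j"
proof -
  have "occurs_at (concat (ds @ es) @ w) u (i + length (concat cs))"
    using assms(1) by (simp add: occurs_at_append add.assoc)
  then show ?thesis using occurs_at_decode_prefix assms(2) by blast
qed

text \<open>As \<open>k > 0\<close>, the block following an \<open>s\<close> begins with
  \<open>r\<close>; two consecutive factors \<open>s\<close> never occur.\<close>

lemma s_then_r: "occurs_at (s @ w) u i \<Longrightarrow> occurs_at (concat [s, r] @ w) u i"
proof -
  assume "occurs_at (s @ w) u i"
  then obtain j where "j \<in> {k, k + 1}" "occurs_at (concat (s # replicate j r @ [s]) @ w) u i"
    using after_s by blast
  moreover from this k_pos obtain j' where "j = Suc j'" by (cases j) auto
  ultimately have "occurs_at (concat ([s, r] @ replicate j' r @ [s]) @ w) u i" by simp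
  then show ?thesis by (rule occurs_at_decode_prefix) auto
qed

text \<open>All three are read off from \<open>s\<close>, then \<open>k + 1\<close> copies of
  \<open>r\<close>, then \<open>s\<close>; here \<open>k + 1\<close> is at least 2.\<close>

lemma products_of_two_occur:
  "\<exists>i. occurs_at (concat [r, r] @ w) u i" "\<exists>i. occurs_at (concat [r, s] @ w) u i"
  "\<exists>i. occurs_at (concat [s, r] @ w) u i"
proof -
  obtain k' where k': "k = Suc k'" using k_pos by (cases k) auto
  obtain i where i: "occurs_at (concat (s # replicate (k + 1) r @ [s]) @ w) u i"
    using s_power_s_occurs by blast
  have "occurs_at (concat ([s] @ [r, r] @ (replicate k' r @ [s])) @ w) u i"
    using i k' by simp
  then show "\<exists>i. occurs_at (concat [r, r] @ w) u i" by (rule occurs_infix) auto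
  have "occurs_at (concat ((s # replicate k r) @ [r, s] @ []) @ w) u i"
    using i by (simp add: replicate_append_same[symmetric])
  then show "\<exists>i. occurs_at (concat [r, s] @ w) u i" by (rule occurs_infix) auto
  have "occurs_at (concat ([] @ [s, r] @ (replicate k r @ [s])) @ w) u i"
    using i by simp
  then show "\<exists>i. occurs_at (concat [s, r] @ w) u i" by (rule occurs_infix) auto
qed

text \<open>Every occurrence of \<open>w\<close> is reached from position 0 by a product of return
  words, so \<open>v\<close> would have the letter 0 at all of them. Closure under exchange yields
  one with letter 1.\<close>

lemma not_both_stable: "\<not> (stable r \<and> stable s)"
proof
  assume stable: "stable r \<and> stable s"
  obtain i where i: "occurs_at w u i" "v i = 1"
    using occurs_at_with_letter[OF exchange_closed] occurs_at_q u_eq by metis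
  \<comment> \<open>The first \<open>i\<close> blocks reach at least to position \<open>i\<close>,
    so \<open>i\<close> is a boundary in their decomposition.\<close>
  let ?cs = "concat (map block [0..<0 + i])"
  have len: "q i = length (concat ?cs)" "occurs_at (concat ?cs @ w) u 0"
    using blocks_at[of 0 i] q_0 occurs_at_q[of i] by (auto simp: occurs_at_append)
  have "i \<le> q i" using strict_mono_imp_increasing[OF q_strict_mono] by simp
  moreover have cs: "?cs \<in> lists {r, s}" by (auto split: if_splits)
  ultimately obtain n where n: "i = length (concat (take n ?cs))"
    using occurrence_position[OF len(2) cs, of i] i len(1) by auto
  have "sum_list (concat ds) = 0" if "ds \<in> lists {r, s}" for ds
    using that stable by (induction ds) (auto simp: stable_iff_sum_list)
  moreover have "take n ?cs \<in> lists {r, s}" using cs by (meson in_listsD in_listsI in_set_takeD)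
  ultimately have "sum_list (concat (take n ?cs)) = 0" by blast
  moreover have "occurs_at (concat (take n ?cs @ drop n ?cs) @ w) u 0" using len by simp
  then have "occurs_at (concat (take n ?cs)) u 0"
    unfolding concat_append occurs_at_append by blast
  ultimately show False using v_shift[of "concat (take n ?cs)" 0] n i v_0 by simp
qed

text \<open>The first \<open>s\<close> makes the parity odd, the copies of \<open>r\<close> keep it,
  and the last \<open>s\<close> restores it.\<close>

lemma first_return_Cons_s:
  assumes "sum_list r = 0" "sum_list s = 1"
  shows "first_return (s # replicate j r @ [s])"
proof -
  have r: "sum_list (concat (replicate m r)) = 0" for m
    by (induction m) (use assms in auto)
  have "sum_list (concat (take n (s # replicate j r @ [s]))) = 1"
    if n: "0 < n" "n < length (s # replicate j r @ [s])" for n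
  proof -
    obtain n' where "n = Suc n'" "n' \<le> j" using n by (cases n) auto
    then have "take n (s # replicate j r @ [s]) = s # replicate n' r" by simp
    then show ?thesis using r assms by simp
  qed
  then show ?thesis using r assms by (simp add: first_return_def)
qed

section \<open>The three types of prefixes\<close>

lemma return_words_SU:
  assumes "type_SU r s"
  shows "\<exists>A B C. A \<noteq> [] \<and> B \<noteq> [] \<and> C \<noteq> [] \<and> distinct [A, B, C] \<and>
    return_words v x = {A, B, C} \<and> S_word (A @ [0]) = concat [r] \<and>
    S_word (B @ [0]) = concat (s # replicate (k + 1) r @ [s]) \<and>
    S_word (C @ [0]) = concat (s # replicate k r @ [s])"
proof (rule three_return_words[OF refl])
  let ?CS = "{[r], s # replicate (k + 1) r @ [s], s # replicate k r @ [s]}"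
  have sums: "sum_list r = 0" "sum_list s = 1"
    using assms by (auto simp: type_SU_def stable_iff_sum_list)
  show "distinct [[r], s # replicate (k + 1) r @ [s], s # replicate k r @ [s]]" by simp
  show "?CS \<subseteq> lists {r, s}" by auto
  show "first_return cs" if "cs \<in> ?CS" for cs
    using that sums first_return_Cons_s by (auto simp: first_return_def simp del: replicate_Suc)
  show "\<exists>i. occurs_at (concat cs @ w) u i" if "cs \<in> ?CS" for cs
  proof -
    have "\<exists>i. occurs_at (concat [r] @ w) u i"
      using products_of_two_occur(1) occurs_infix[of "[]" "[r]" "[r]"] by auto
    then show ?thesis using that s_power_s_occurs by blast
  qed
  show "\<exists>cs\<in>?CS. occurs_at (concat cs @ w) u i" if "occurs_at w u i" for i
    using next_return_word'[OF that] after_s[of i] by auto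
qed

text \<open>The stable \<open>s\<close> is a first return by itself. After an \<open>r\<close> the
  parity stays odd until the next \<open>r\<close>, and at most one \<open>s\<close> can come in
  between.\<close>

lemma return_words_US:
  assumes "type_US r s"
  shows "\<exists>A B C. A \<noteq> [] \<and> B \<noteq> [] \<and> C \<noteq> [] \<and> distinct [A, B, C] \<and>
    return_words v x = {A, B, C} \<and> S_word (A @ [0]) = concat [r, r] \<and>
    S_word (B @ [0]) = concat [r, s, r] \<and> S_word (C @ [0]) = concat [s]"
proof (rule three_return_words[OF refl])
  let ?CS = "{[r, r], [r, s, r], [s]}"
  have sums: "sum_list r = 1" "sum_list s = 0"
    using assms by (auto simp: type_US_def stable_iff_sum_list)
  have rs: "occurs_at (concat [r, s, r] @ w) u i" if "occurs_at (concat [r, s] @ w) u i" for i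
    using that s_then_r[of "i + length r"] by (simp add: occurs_at_append add.assoc)
  show "distinct [[r, r], [r, s, r], [s]]" using r_neq_s by simp
  show "?CS \<subseteq> lists {r, s}" by auto
  show "first_return cs" if "cs \<in> ?CS" for cs
    using that sums by (auto simp: first_return_def less_Suc_eq numeral_eq_Suc)
  show "\<exists>i. occurs_at (concat cs @ w) u i" if "cs \<in> ?CS" for cs
  proof -
    have "\<exists>i. occurs_at (concat [s] @ w) u i"
      using products_of_two_occur(3) occurs_infix[of "[]" "[s]" "[r]"] by auto
    then show ?thesis using that products_of_two_occur rs by blast
  qed
  show "\<exists>cs\<in>?CS. occurs_at (concat cs @ w) u i" if "occurs_at w u i" for i
  proof -
    have "occurs_at (s @ w) u i \<or> occurs_at (r @ w) u i"
      using next_return_word'[OF that] by blast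
    then consider "occurs_at (s @ w) u i" | "occurs_at (r @ w) u i" by blast
    then show ?thesis
    proof cases
      case 2
      then obtain z where "z \<in> {r, s}" "occurs_at (concat [r, z] @ w) u i"
        using next_return_word'[of "i + length r"] by (auto simp: occurs_at_append add.assoc)
      then show ?thesis using rs[of i] by blast
    qed simp
  qed
qed

text \<open>Any two consecutive factors restore the parity, and the pair of two factors
  \<open>s\<close> is excluded by \<open>s_then_r\<close>.\<close>

lemma return_words_UU:
  assumes "type_UU r s"
  shows "\<exists>A B C. A \<noteq> [] \<and> B \<noteq> [] \<and> C \<noteq> [] \<and> distinct [A, B, C] \<and>
    return_words v x = {A, B, C} \<and> S_word (A @ [0]) = concat [r, r] \<and>
    S_word (B @ [0]) = concat [r, s] \<and> S_word (C @ [0]) = concat [s, r]"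
proof (rule three_return_words[OF refl])
  let ?CS = "{[r, r], [r, s], [s, r]}"
  have sums: "sum_list r = 1" "sum_list s = 1"
    using assms by (auto simp: type_UU_def stable_iff_sum_list)
  show "distinct [[r, r], [r, s], [s, r]]" using r_neq_s by simp
  show "?CS \<subseteq> lists {r, s}" by auto
  show "first_return cs" if "cs \<in> ?CS" for cs
    using that sums by (auto simp: first_return_def less_Suc_eq numeral_eq_Suc)
  show "\<exists>i. occurs_at (concat cs @ w) u i" if "cs \<in> ?CS" for cs
    using that products_of_two_occur by blast
  show "\<exists>cs\<in>?CS. occurs_at (concat cs @ w) u i" if "occurs_at w u i" for i
  proof -
    have "occurs_at (s @ w) u i \<or> occurs_at (r @ w) u i"
      using next_return_word'[OF that] by blast
    then consider "occurs_at (s @ w) u i" | "occurs_at (r @ w) u i" by blast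
    then show ?thesis
    proof cases
      case 1
      then show ?thesis using s_then_r by blast
    next
      case 2
      then obtain z where "z \<in> {r, s}" "occurs_at (concat [r, z] @ w) u i"
        using next_return_word'[of "i + length r"] by (auto simp: occurs_at_append add.assoc)
      then show ?thesis by blast
    qed
  qed
qed

end

theorem theorem3p10:
  fixes u v :: "nat \<Rightarrow> bit" and x w r s :: "bit list" and k :: nat
  assumes "cs_rote v" and "v 0 = 0"
    and "u = S_seq v" and "standard_sturmian u"
    and "x \<noteq> []" and "prefix_of x v" and "w = S_word x"
    and "return_words u w = {r, s}" and "r \<noteq> s" and "more_frequent_return u w r s"
    and "k > 0" and "concatenation_of u {word_power r k @ s, word_power r (k + 1) @ s}"
  shows "\<exists>A B C. A \<noteq> [] \<and> B \<noteq> [] \<and> C \<noteq> [] \<and> distinct [A, B, C] \<and>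
    return_words v x = {A, B, C} \<and>
    (type_SU r s \<longrightarrow>
       S_word (A @ [0]) = r \<and>
       S_word (B @ [0]) = s @ word_power r (k + 1) @ s \<and>
       S_word (C @ [0]) = s @ word_power r k @ s) \<and>
    (type_US r s \<longrightarrow>
       S_word (A @ [0]) = r @ r \<and>
       S_word (B @ [0]) = r @ s @ r \<and>
       S_word (C @ [0]) = s) \<and>
    (type_UU r s \<longrightarrow>
       S_word (A @ [0]) = r @ r \<and>
       S_word (B @ [0]) = r @ s \<and>
       S_word (C @ [0]) = s @ r)"
proof -
  obtain b where b: "\<And>n. b n \<in> {word_power r k @ s, word_power r (k + 1) @ s}"
      "\<And>n. prefix_of (concat (map b [0..<n])) u"
    using assms(12) unfolding concatenation_of_def by blast
  \<comment> \<open>Each block is recorded by its exponent; \<open>q n\<close> below is the start of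
    the \<open>n\<close>-th block.\<close>
  have "\<exists>j\<in>{k, k + 1}. b n = concat (replicate j r @ [s])" for n
    using b(1)[of n] by (auto simp: word_power_def)
  then obtain e where e: "\<And>n. e n \<in> {k, k + 1}" "\<And>n. b n = concat (replicate (e n) r @ [s])"
    by metis
  define q where "q n = length (concat (map b [0..<n]))" for n
  interpret rote_blocks u w r s k e q v x
  proof
    show "return_words u w = {r, s}" "r \<noteq> s" "k > 0" "u = S_seq v" "x \<noteq> []" "v 0 = 0"
      "w = S_word x" by fact+
    show "e n \<in> {k, k + 1}" for n by (fact e)
    show "q 0 = 0" by (simp add: q_def)
    show "q (Suc n) = q n + length (concat (replicate (e n) r @ [s]))" for n
      by (simp add: q_def e(2))
    show "occurs_at (concat (replicate (e n) r @ [s])) u (q n)" for n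
      using b(2)[of "Suc n"] e(2)[of n] by (simp add: prefix_of_def occurs_at_append q_def)
    show "\<exists>n\<ge>N. u (n + p) \<noteq> u n" if "p > 0" for p N
      using sturmian_not_eventually_periodic assms(4) that unfolding standard_sturmian_def by blast
    show "\<forall>f \<in> factors v. exchange f \<in> factors v"
      using assms(1) unfolding cs_rote_def by blast
    show "hd x = 0"
      using assms(2,5,6) by (simp add: prefix_of_def occurs_at_iff hd_conv_nth)
  qed
  \<comment> \<open>The witnesses depend on the type, so the type is fixed before they are chosen;
    the other two implications are then vacuous.\<close>
  consider "type_SU r s" | "type_US r s" | "type_UU r s"
    using not_both_stable unfolding type_SU_def type_US_def type_UU_def by blast
  then show ?thesis
  proof cases
    case 1
    then have "\<not> type_US r s" "\<not> type_UU r s"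
      by (auto simp: type_SU_def type_US_def type_UU_def)
    then show ?thesis using 1 return_words_SU[OF 1] by (simp add: word_power_def)
  next
    case 2
    then have "\<not> type_SU r s" "\<not> type_UU r s"
      by (auto simp: type_SU_def type_US_def type_UU_def)
    then show ?thesis using 2 return_words_US[OF 2] by simp
  next
    case 3
    then have "\<not> type_SU r s" "\<not> type_US r s"
      by (auto simp: type_SU_def type_US_def type_UU_def)
    then show ?thesis using 3 return_words_UU[OF 3] by simp
  qed
qed

end
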